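(* Let $s$ and $t$ be positive integers and let $H_1,\ldots,H_s$, $H'_1,\ldots,H'_t$ be loosely connected ordered graphs. If $(H_i,H'_j)$ is Ramsey finite for all $i\in[s]$, $j\in[t]$, then $(H_1\sqcup\cdots\sqcup H_s,\ H'_1\sqcup\cdots\sqcup H'_t)$ is Ramsey finite.
   Context: An ordered graph is a finite simple graph together with a linear order of its vertex set. A copy of an ordered graph $H$ in $F$ is a subgraph of $F$ (with inherited order) isomorphic to $H$ via an order-preserving bijection. For ordered graphs $H,H'$, $R_<(H,H')$ is the set of ordered graphs $F$ such that every red/blue coloring of the edges of $F$ contains a red copy of $H$ or a blue copy of $H'$; $F\in R_<(H,H')$ is minimal if no proper subgraph of $F$ lies in $R_<(H,H')$; $(H,H')$ is Ramsey finite if $R_<(H,H')$ has only finitely many minimal elements (up to order-preserving isomorphism). An interval of an ordered graph $G$ is a set of consecutive vertices. An ordered graph $G$ with at least two vertices is loosely connected if for every partition $V(G)=V_1\,\dot\cup\, V_2$ into two nonempty disjoint intervals there is an edge with one endpoint in $V_1$ and the other in $V_2$. The intervally disjoint union $G\sqcup G'$ of ordered graphs is the vertex-disjoint union of $G$ and $G'$ in which all vertices of $G$ precede all vertices of $G'$. *)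

theory Defs
  imports Main "HOL-Library.Product_Lexorder"
begin

text \<open>The linear order of the vertex set is the one inherited from the vertex type, so subgraphs
  carry the inherited order automatically.\<close>

record 'a ograph =
  verts :: "'a set"
  edges :: "'a set set"

definition ordered_graph :: "'a::linorder ograph \<Rightarrow> bool" where
  "ordered_graph G \<longleftrightarrow> finite (verts G) \<and> (\<forall>e\<in>edges G. e \<subseteq> verts G \<and> card e = 2)"

definition subgraph :: "'a::linorder ograph \<Rightarrow> 'a ograph \<Rightarrow> bool" where
  "subgraph G F \<longleftrightarrow> ordered_graph G \<and> verts G \<subseteq> verts F \<and> edges G \<subseteq> edges F"

definition order_isomorphic :: "'a::linorder ograph \<Rightarrow> 'b::linorder ograph \<Rightarrow> bool" where
  "order_isomorphic G H \<longleftrightarrow>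
     (\<exists>f. bij_betw f (verts G) (verts H) \<and> strict_mono_on (verts G) f \<and>
          (\<forall>u\<in>verts G. \<forall>v\<in>verts G. {u, v} \<in> edges G \<longleftrightarrow> {f u, f v} \<in> edges H))"

definition is_copy :: "'a::linorder ograph \<Rightarrow> 'b::linorder ograph \<Rightarrow> 'b ograph \<Rightarrow> bool" where
  "is_copy H F G \<longleftrightarrow> subgraph G F \<and> order_isomorphic H G"

datatype colour = Red | Blue

text \<open>Colourings are total functions; only their values on the edges of \<open>F\<close> matter.\<close>

definition ramsey_graphs ::
    "'a::linorder ograph \<Rightarrow> 'b::linorder ograph \<Rightarrow> 'c::linorder ograph set" where
  "ramsey_graphs H H' =
     {F. ordered_graph F \<and>
         (\<forall>c :: 'c set \<Rightarrow> colour.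
            (\<exists>G. is_copy H F G \<and> (\<forall>e\<in>edges G. c e = Red)) \<or>
            (\<exists>G. is_copy H' F G \<and> (\<forall>e\<in>edges G. c e = Blue)))}"

definition minimal_ramsey_graphs ::
    "'a::linorder ograph \<Rightarrow> 'b::linorder ograph \<Rightarrow> 'c::linorder ograph set" where
  "minimal_ramsey_graphs H H' =
     {F \<in> ramsey_graphs H H'. \<forall>G. subgraph G F \<and> G \<noteq> F \<longrightarrow> G \<notin> ramsey_graphs H H'}"

text \<open>Every (finite) ordered graph is order-isomorphic to one whose vertices are natural numbers
  in their usual order, so ranging over \<open>nat ograph\<close> loses nothing up to isomorphism.\<close>

definition ramsey_finite :: "'a::linorder ograph \<Rightarrow> 'b::linorder ograph \<Rightarrow> bool" where
  "ramsey_finite H H' \<longleftrightarrow>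
     (\<exists>M :: nat ograph set. finite M \<and> M \<subseteq> minimal_ramsey_graphs H H' \<and>
        (\<forall>F :: nat ograph. F \<in> minimal_ramsey_graphs H H' \<longrightarrow> (\<exists>G\<in>M. order_isomorphic F G)))"

definition interval_of :: "'a::linorder ograph \<Rightarrow> 'a set \<Rightarrow> bool" where
  "interval_of G I \<longleftrightarrow>
     I \<subseteq> verts G \<and> (\<forall>x\<in>I. \<forall>y\<in>I. \<forall>z\<in>verts G. x \<le> z \<and> z \<le> y \<longrightarrow> z \<in> I)"

definition loosely_connected :: "'a::linorder ograph \<Rightarrow> bool" where
  "loosely_connected G \<longleftrightarrow> card (verts G) \<ge> 2 \<and>
     (\<forall>V1 V2. interval_of G V1 \<and> interval_of G V2 \<and> V1 \<noteq> {} \<and> V2 \<noteq> {} \<and>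
        V1 \<inter> V2 = {} \<and> V1 \<union> V2 = verts G \<longrightarrow>
        (\<exists>u\<in>V1. \<exists>v\<in>V2. {u, v} \<in> edges G))"

text \<open>The union \<open>G 1 \<squnion> \<dots> \<squnion> G n\<close>. A vertex \<open>v\<close> of \<open>G i\<close> becomes \<open>(i, v)\<close>; in the lexicographic
  order of pairs all vertices of \<open>G i\<close> precede all vertices of \<open>G j\<close> whenever \<open>i < j\<close>.\<close>

definition interval_union :: "nat \<Rightarrow> (nat \<Rightarrow> 'a::linorder ograph) \<Rightarrow> (nat \<times> 'a) ograph" where
  "interval_union n G =
     \<lparr> verts = {(i, v). i \<in> {1..n} \<and> v \<in> verts (G i)},
       edges = {{(i, u), (i, v)} | i u v. i \<in> {1..n} \<and> {u, v} \<in> edges (G i)} \<rparr>"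

end

theory Submission
  imports Defs
begin

text \<open>
  Let \<open>F\<close> be a Ramsey graph for the two unions and let \<open>v\<close> be the least vertex for which the part
  \<open>F\<^sub>0\<close> of \<open>F\<close> up to \<open>v\<close> is Ramsey for \<open>(H\<^sub>1, H'\<^sub>1)\<close>. Colour the part of \<open>F\<close> before \<open>v\<close> without red
  \<open>H\<^sub>1\<close> and blue \<open>H'\<^sub>1\<close> and colour all edges meeting or crossing \<open>v\<close> red. Every red copy of \<open>H\<^sub>1\<close>
  then reaches \<open>v\<close>, while every blue copy of \<open>H'\<^sub>1\<close>, being loosely connected, starts after \<open>v\<close>. Hence
  the part \<open>F\<^sub>1\<close> of \<open>F\<close> after \<open>v\<close> is Ramsey for \<open>(H\<^sub>2 \<squnion> \<dots> \<squnion> H\<^sub>s, H'\<^sub>1 \<squnion> \<dots> \<squnion> H'\<^sub>t)\<close>, and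
  symmetrically for \<open>(H\<^sub>1 \<squnion> \<dots> \<squnion> H\<^sub>s, H'\<^sub>2 \<squnion> \<dots> \<squnion> H'\<^sub>t)\<close>. Conversely, Ramsey subgraphs of \<open>F\<^sub>0\<close>
  and, for the two latter pairs, of \<open>F\<^sub>1\<close> together form a Ramsey graph for the original pair. By
  induction every Ramsey graph has a Ramsey subgraph of bounded order.
\<close>

section \<open>Embeddings, colour classes and intervally disjoint unions\<close>

definition contains :: "'a::linorder ograph \<Rightarrow> 'b::linorder ograph \<Rightarrow> bool" where
  "contains H F \<longleftrightarrow> (\<exists>f. strict_mono_on (verts H) f \<and> f ` verts H \<subseteq> verts F \<and>
     (\<forall>e\<in>edges H. f ` e \<in> edges F))"

definition colour_class :: "('a set \<Rightarrow> colour) \<Rightarrow> colour \<Rightarrow> 'a ograph \<Rightarrow> 'a ograph" where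
  "colour_class c q F = \<lparr>verts = verts F, edges = {e \<in> edges F. c e = q}\<rparr>"

definition induced :: "'a ograph \<Rightarrow> 'a set \<Rightarrow> 'a ograph" where
  "induced F S = \<lparr>verts = verts F \<inter> S, edges = {e \<in> edges F. e \<subseteq> S}\<rparr>"

text \<open>An arbitrary index set lets the induction drop leading components and pass to
  \<open>{Suc a..s}\<close>; the empty index set gives the empty graph. Edges are whole images under
  \<open>Pair i\<close>, so an embedding \<open>f\<close> acts on them as \<open>f\<close> Pair i
  \<open>e\<close> without naming endpoints.\<close>

definition interval_union_on :: "nat set \<Rightarrow> (nat \<Rightarrow> 'a::linorder ograph) \<Rightarrow> (nat \<times> 'a) ograph" where
  "interval_union_on I G =
     \<lparr>verts = Sigma I (\<lambda>i. verts (G i)), edges = (\<Union>i\<in>I. (`) (Pair i) ` edges (G i))\<rparr>"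

definition graph_union :: "'a ograph \<Rightarrow> 'a ograph \<Rightarrow> 'a ograph" where
  "graph_union A B = \<lparr>verts = verts A \<union> verts B, edges = edges A \<union> edges B\<rparr>"

text \<open>The form of Ramsey finiteness that survives the induction: one bound on the order of
  some Ramsey subgraph, with no mention of minimality or isomorphism. It is equivalent to
  \<open>ramsey_finite\<close>, by \<open>ramsey_finite_imp_bounded\<close> and
  \<open>ramsey_bounded_imp_finite\<close>.\<close>

definition ramsey_bounded :: "'a::linorder ograph \<Rightarrow> 'b::linorder ograph \<Rightarrow> bool" where
  "ramsey_bounded H H' \<longleftrightarrow> (\<exists>n. \<forall>F :: nat ograph. F \<in> ramsey_graphs H H' \<longrightarrow>
     (\<exists>G \<in> ramsey_graphs H H'. subgraph G F \<and> card (verts G) \<le> n))"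

lemma verts_simps [simp]:
  "verts (colour_class c q F) = verts F"
  "verts (induced F S) = verts F \<inter> S"
  "verts (interval_union_on I G) = Sigma I (\<lambda>i. verts (G i))"
  "verts (graph_union A B) = verts A \<union> verts B"
  by (simp_all add: colour_class_def induced_def interval_union_on_def graph_union_def)

lemma edges_simps [simp]:
  "edges (colour_class c q F) = {e \<in> edges F. c e = q}"
  "edges (induced F S) = {e \<in> edges F. e \<subseteq> S}"
  "edges (interval_union_on I G) = (\<Union>i\<in>I. (`) (Pair i) ` edges (G i))"
  "edges (graph_union A B) = edges A \<union> edges B"
  by (simp_all add: colour_class_def induced_def interval_union_on_def graph_union_def)

lemma ordered_graph_edgeE:
  assumes "ordered_graph G" "e \<in> edges G"
  obtains u v where "e = {u, v}" "u < v" "u \<in> verts G" "v \<in> verts G"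
proof -
  have "card e = 2" "e \<subseteq> verts G" using assms by (auto simp: ordered_graph_def)
  then obtain x y where "e = {x, y}" "x \<noteq> y" by (auto simp: card_2_iff)
  with \<open>e \<subseteq> verts G\<close> that[of x y] that[of y x] show thesis by (auto simp: neq_iff)
qed

lemma ordered_graph_induced: "ordered_graph F \<Longrightarrow> ordered_graph (induced F S)"
  by (auto simp: ordered_graph_def)

lemma ordered_graph_union:
  "ordered_graph A \<Longrightarrow> ordered_graph B \<Longrightarrow> ordered_graph (graph_union A B)"
  by (auto simp: ordered_graph_def)

lemma ordered_graph_interval_union_on:
  assumes "finite I" "\<And>i. i \<in> I \<Longrightarrow> ordered_graph (G i)"
  shows "ordered_graph (interval_union_on I G)"
  using assms by (fastforce simp: ordered_graph_def card_image inj_on_def)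

text \<open>Well-formedness makes every edge a pair, which is what the set-builder on the left can
  see.\<close>

lemma interval_union_eq:
  assumes "\<And>i. i \<in> {1..n} \<Longrightarrow> ordered_graph (G i)"
  shows "interval_union n G = interval_union_on {1..n} G"
proof -
  have "{{(i, u), (i, v)} | i u v. i \<in> {1..n} \<and> {u, v} \<in> edges (G i)} =
      (\<Union>i\<in>{1..n}. (`) (Pair i) ` edges (G i))" (is "?L = ?R")
  proof
    show "?L \<subseteq> ?R"
    proof
      fix e assume "e \<in> ?L"
      then obtain i u v where "i \<in> {1..n}" "{u, v} \<in> edges (G i)" "e = Pair i ` {u, v}" by auto
      then show "e \<in> ?R" by blast
    qed
    show "?R \<subseteq> ?L"
    proof
      fix e assume "e \<in> ?R"
      then obtain i d where *: "i \<in> {1..n}" "d \<in> edges (G i)" "e = Pair i ` d" by auto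
      with assms obtain u v where "d = {u, v}" by (meson ordered_graph_edgeE)
      with * show "e \<in> ?L" by auto
    qed
  qed
  then show ?thesis
    by (auto simp: interval_union_def interval_union_on_def)
qed

text \<open>Copies need not be induced subgraphs. Given an embedding, the copy is taken with the
  images of the edges of \<open>H\<close> as its only edges, so non-edges are respected by
  injectivity alone, and injectivity comes from strict monotonicity.\<close>

lemma copy_iff_contains:
  assumes H: "ordered_graph H"
  shows "(\<exists>G. is_copy H F G \<and> (\<forall>e\<in>edges G. c e = q)) \<longleftrightarrow> contains H (colour_class c q F)"
proof
  assume "\<exists>G. is_copy H F G \<and> (\<forall>e\<in>edges G. c e = q)"
  then obtain G f where G: "subgraph G F" "\<forall>e\<in>edges G. c e = q"
    and f: "bij_betw f (verts H) (verts G)" "strict_mono_on (verts H) f"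
      "\<forall>u\<in>verts H. \<forall>v\<in>verts H. {u, v} \<in> edges H \<longleftrightarrow> {f u, f v} \<in> edges G"
    by (auto simp: is_copy_def order_isomorphic_def)
  have "f ` e \<in> edges G" if e: "e \<in> edges H" for e
  proof -
    obtain u v where "e = {u, v}" "u \<in> verts H" "v \<in> verts H"
      using H e by (rule ordered_graph_edgeE)
    with f(3) e show ?thesis by simp
  qed
  moreover have "f ` verts H \<subseteq> verts F"
    using f(1) G(1) by (auto simp: bij_betw_def subgraph_def)
  ultimately show "contains H (colour_class c q F)"
    using f(2) G unfolding contains_def subgraph_def by (intro exI[of _ f]) auto
next
  assume "contains H (colour_class c q F)"
  then obtain f where f: "strict_mono_on (verts H) f" "f ` verts H \<subseteq> verts F"
      "\<forall>e\<in>edges H. f ` e \<in> edges F \<and> c (f ` e) = q"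
    by (auto simp: contains_def)
  let ?G = "\<lparr>verts = f ` verts H, edges = (`) f ` edges H\<rparr>"
  have inj: "inj_on f (verts H)" using f(1) by (rule strict_mono_on_imp_inj_on)
  have "ordered_graph ?G"
    using H inj by (auto simp: ordered_graph_def card_image inj_on_subset)
  moreover have "{u, v} \<in> edges H \<longleftrightarrow> {f u, f v} \<in> (`) f ` edges H"
    if "u \<in> verts H" "v \<in> verts H" for u v
  proof
    assume "{f u, f v} \<in> (`) f ` edges H"
    then obtain e where e: "e \<in> edges H" "f ` e = f ` {u, v}" by auto
    moreover have "e \<subseteq> verts H" using H e by (auto simp: ordered_graph_def)
    ultimately have "e = {u, v}" using inj_on_image_eq_iff[OF inj, of e "{u, v}"] that by auto
    with e show "{u, v} \<in> edges H" by simp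
  qed (force intro: image_eqI[of _ _ "{u, v}"])
  ultimately have "is_copy H F ?G"
    using f inj by (auto simp: is_copy_def subgraph_def order_isomorphic_def bij_betw_def
        intro!: exI[of _ f])
  with f show "\<exists>G. is_copy H F G \<and> (\<forall>e\<in>edges G. c e = q)" by (intro exI[of _ ?G]) auto
qed

lemma ramsey_graphs_iff:
  assumes "ordered_graph H" "ordered_graph H'"
  shows "F \<in> ramsey_graphs H H' \<longleftrightarrow> ordered_graph F \<and>
    (\<forall>c. contains H (colour_class c Red F) \<or> contains H' (colour_class c Blue F))"
  using assms by (simp add: ramsey_graphs_def copy_iff_contains)

text \<open>Apply the hypothesis to the colouring with both colours exchanged. This later yields the
  second half of the cutting argument from the first.\<close>

lemma ramsey_graphs_swap:
  assumes "F \<in> ramsey_graphs H H'"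
  shows "F \<in> ramsey_graphs H' H"
proof -
  let ?s = "\<lambda>q. case q of Red \<Rightarrow> Blue | Blue \<Rightarrow> Red"
  have s: "?s q = Red \<longleftrightarrow> q = Blue" "?s q = Blue \<longleftrightarrow> q = Red" for q
    by (cases q; simp)+
  have "(\<exists>G. is_copy H' F G \<and> (\<forall>e\<in>edges G. c e = Red)) \<or>
        (\<exists>G. is_copy H F G \<and> (\<forall>e\<in>edges G. c e = Blue))" for c
  proof -
    have "(\<exists>G. is_copy H F G \<and> (\<forall>e\<in>edges G. ?s (c e) = Red)) \<or>
          (\<exists>G. is_copy H' F G \<and> (\<forall>e\<in>edges G. ?s (c e) = Blue))"
      using assms unfolding ramsey_graphs_def mem_Collect_eq
      by (elim conjE allE[of _ "\<lambda>e. ?s (c e)"])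
    then show ?thesis unfolding s by blast
  qed
  with assms show ?thesis unfolding ramsey_graphs_def by blast
qed

lemma ramsey_graphs_commute: "ramsey_graphs H H' = ramsey_graphs H' H"
  by (auto intro: ramsey_graphs_swap)

section \<open>Embeddings of unions and of loosely connected graphs\<close>

lemma contains_mono:
  "contains H A \<Longrightarrow> verts A \<subseteq> verts B \<Longrightarrow> edges A \<subseteq> edges B \<Longrightarrow> contains H B"
  unfolding contains_def by (elim exE, rule exI) auto

lemma contains_component:
  assumes "contains (interval_union_on I G) F" "i \<in> I"
  shows "contains (G i) F"
proof -
  obtain f where f: "strict_mono_on (verts (interval_union_on I G)) f"
      "f ` verts (interval_union_on I G) \<subseteq> verts F"
      "\<forall>e\<in>edges (interval_union_on I G). f ` e \<in> edges F"
    using assms(1) by (auto simp: contains_def)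
  have "strict_mono_on (verts (G i)) (\<lambda>x. f (i, x))"
    using f(1) assms(2) by (auto simp: strict_mono_on_def)
  moreover have "(\<lambda>x. f (i, x)) ` e \<in> edges F" if "e \<in> edges (G i)" for e
  proof -
    have "f ` Pair i ` e \<in> edges F" using f(3) assms(2) that by auto
    then show ?thesis by (simp add: image_image)
  qed
  ultimately show ?thesis
    using f(2) assms(2) unfolding contains_def by (intro exI[of _ "\<lambda>x. f (i, x)"]) auto
qed

text \<open>The two embeddings are glued into \<open>h\<close>. Monotonicity between component
  \<open>a\<close> and the later ones holds because \<open>v\<close> separates their images, in the
  same direction as the lexicographic order.\<close>

lemma contains_interval_union_join:
  assumes "contains (G a) A" "contains (interval_union_on {Suc a..s} G) B"
    and "a \<le> s" "verts A \<subseteq> {..v}" "verts B \<subseteq> {v<..}"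
    and "verts A \<union> verts B \<subseteq> verts F" "edges A \<union> edges B \<subseteq> edges F"
  shows "contains (interval_union_on {a..s} G) F"
proof -
  obtain f where f: "strict_mono_on (verts (G a)) f" "f ` verts (G a) \<subseteq> verts A"
      "\<forall>e\<in>edges (G a). f ` e \<in> edges A"
    using assms(1) by (auto simp: contains_def)
  obtain g where g: "strict_mono_on (verts (interval_union_on {Suc a..s} G)) g"
      "g ` verts (interval_union_on {Suc a..s} G) \<subseteq> verts B"
      "\<forall>e\<in>edges (interval_union_on {Suc a..s} G). g ` e \<in> edges B"
    using assms(2) by (auto simp: contains_def)
  define h where "h p = (if fst p = a then f (snd p) else g p)" for p
  have ha: "h (a, x) = f x" for x by (simp add: h_def)
  have hi: "h (i, x) = g (i, x)" if "i \<in> {Suc a..s}" for i x using that by (simp add: h_def)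
  have fA: "f x \<in> verts A" if "x \<in> verts (G a)" for x using f(2) that by auto
  have gB: "g (i, x) \<in> verts B" if "i \<in> {Suc a..s}" "x \<in> verts (G i)" for i x
    using g(2) that by auto
  have split: "i = a \<or> i \<in> {Suc a..s}" if "i \<in> {a..s}" for i using that by auto
  have "h (i, x) < h (j, y)"
    if *: "i \<in> {a..s}" "j \<in> {a..s}" "x \<in> verts (G i)" "y \<in> verts (G j)" "(i, x) < (j, y)"
    for i j x y
  proof -
    consider "i = a" "j = a" | "i = a" "j \<in> {Suc a..s}" | "i \<in> {Suc a..s}" "j \<in> {Suc a..s}"
      using split[of i] split[of j] *(1,2,5) by auto
    then show ?thesis
    proof cases
      case 1 then show ?thesis using * f(1) by (auto simp: ha strict_mono_on_def)
    next
      case 2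
      then have "f x \<in> verts A" "g (j, y) \<in> verts B" using fA gB * by auto
      then have "f x \<le> v" "v < g (j, y)" using assms(4,5) by auto
      then show ?thesis using 2 by (simp add: ha hi)
    next
      case 3 then show ?thesis using * g(1) by (auto simp: hi strict_mono_on_def)
    qed
  qed
  then have "strict_mono_on (verts (interval_union_on {a..s} G)) h"
    by (auto simp: strict_mono_on_def)
  moreover have "h (i, x) \<in> verts F" if "i \<in> {a..s}" "x \<in> verts (G i)" for i x
    using split[OF that(1)] fA[of x] gB[of i x] that assms(6) by (auto simp: ha hi)
  moreover have "h ` Pair i ` d \<in> edges F" if "i \<in> {a..s}" "d \<in> edges (G i)" for i d
    using split[OF that(1)]
  proof
    assume "i = a"
    then have "h ` Pair i ` d = f ` d" by (simp add: image_image ha)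
    then show ?thesis using f(3) that assms(7) \<open>i = a\<close> by auto
  next
    assume i: "i \<in> {Suc a..s}"
    then have "h ` Pair i ` d = g ` Pair i ` d" by (simp add: image_image hi)
    moreover have "g ` Pair i ` d \<in> edges B" using g(3) that i by fastforce
    ultimately show ?thesis using assms(7) by auto
  qed
  ultimately show ?thesis unfolding contains_def by (intro exI[of _ h]) auto
qed

text \<open>Split the vertices by \<open>g x < v\<close> and by \<open>g x \<le> v\<close>. If both
  classes of a split were nonempty, loose connectivity would give an edge whose image crosses or
  meets \<open>v\<close>. What remains besides the two claimed cases is that everything maps to
  \<open>v\<close>, impossible for an injective map on at least two vertices.\<close>

lemma loosely_connected_one_side:
  fixes g :: "'a::linorder \<Rightarrow> 'b::linorder"
  assumes K: "loosely_connected K" and g: "strict_mono_on (verts K) g"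
    and e: "\<And>e. e \<in> edges K \<Longrightarrow> g ` e \<subseteq> {..<v} \<or> g ` e \<subseteq> {v<..}"
  shows "g ` verts K \<subseteq> {..<v} \<or> g ` verts K \<subseteq> {v<..}"
proof -
  have mono: "g x \<le> g y" if "x \<in> verts K" "y \<in> verts K" "x \<le> y" for x y
    using strict_mono_onD[OF g, of x y] that by (auto simp: le_less)
  \<comment> \<open>\<open>P\<close> covers both splits at once: it is downward closed and fixed off
    \<open>v\<close>, while \<open>v\<close> itself may fall on either side.\<close>
  have cut: "(\<forall>x\<in>verts K. P (g x)) \<or> (\<forall>x\<in>verts K. \<not> P (g x))"
    if P: "\<And>x y. P y \<Longrightarrow> x \<le> y \<Longrightarrow> P x" "\<And>x. x < v \<Longrightarrow> P x" "\<And>x. v < x \<Longrightarrow> \<not> P x" for P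
  proof (rule ccontr)
    let ?A = "{x \<in> verts K. P (g x)}" and ?B = "{x \<in> verts K. \<not> P (g x)}"
    assume "\<not> ?thesis"
    then have "?A \<noteq> {}" "?B \<noteq> {}" by auto
    moreover have "interval_of K ?A" "interval_of K ?B"
      unfolding interval_of_def using mono P(1) by auto
    moreover have "?A \<inter> ?B = {}" "?A \<union> ?B = verts K" by auto
    ultimately obtain x y where "x \<in> ?A" "y \<in> ?B" "{x, y} \<in> edges K"
      using K unfolding loosely_connected_def by meson
    with e[of "{x, y}"] P(2,3) show False by auto
  qed
  from cut[of "\<lambda>x. x < v"] have 1: "(\<forall>x\<in>verts K. g x < v) \<or> (\<forall>x\<in>verts K. \<not> g x < v)"
    by auto
  from cut[of "\<lambda>x. x \<le> v"] have 2: "(\<forall>x\<in>verts K. g x \<le> v) \<or> (\<forall>x\<in>verts K. \<not> g x \<le> v)"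
    by auto
  have "\<not> g ` verts K \<subseteq> {v}"
  proof
    assume "g ` verts K \<subseteq> {v}"
    then have "card (g ` verts K) \<le> 1" using card_mono[of "{v}"] by auto
    moreover have "card (g ` verts K) = card (verts K)"
      using g by (intro card_image strict_mono_on_imp_inj_on)
    ultimately show False using K by (simp add: loosely_connected_def)
  qed
  with 1 2 show ?thesis by fastforce
qed

section \<open>Splitting and reassembling Ramsey graphs at a vertex\<close>

lemma loosely_connected_verts_nonempty: "loosely_connected K \<Longrightarrow> verts K \<noteq> {}"
  by (auto simp: loosely_connected_def)

text \<open>By contradiction: good colourings \<open>c1\<close> before \<open>v\<close> and
  \<open>c2\<close> after \<open>v\<close> are merged into a colouring of \<open>F\<close>, with red
  on every other edge. Of the choice of \<open>v\<close>, only the failure of the Ramsey property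
  strictly before \<open>v\<close> enters. The choice of red favours one side; the mirrored
  statement follows by exchanging the colours.\<close>

lemma ramsey_after_cut:
  fixes H :: "nat \<Rightarrow> 'a::linorder ograph" and H' :: "nat \<Rightarrow> 'b::linorder ograph"
  assumes F: "F \<in> ramsey_graphs (interval_union_on {a..s} H) (interval_union_on {b..t} H')"
    and ab: "a \<le> s" "b \<le> t"
    and H: "\<And>i. i \<in> {a..s} \<Longrightarrow> ordered_graph (H i)"
    and H': "\<And>j. j \<in> {b..t} \<Longrightarrow> ordered_graph (H' j)" and lc: "loosely_connected (H' b)"
    and before: "induced F {..<v} \<notin> ramsey_graphs (H a) (H' b)"
  shows "induced F {v<..} \<in>
    ramsey_graphs (interval_union_on {Suc a..s} H) (interval_union_on {b..t} H')"
proof (rule ccontr)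
  assume after: "\<not> ?thesis"
  have og: "ordered_graph (interval_union_on {a..s} H)"
      "ordered_graph (interval_union_on {Suc a..s} H)"
      "ordered_graph (interval_union_on {b..t} H')"
    using H H' by (auto intro: ordered_graph_interval_union_on)
  have oF: "ordered_graph F" using F by (simp add: ramsey_graphs_def)
  obtain c1 where c1: "\<not> contains (H a) (colour_class c1 Red (induced F {..<v}))"
      "\<not> contains (H' b) (colour_class c1 Blue (induced F {..<v}))"
    using before H[of a] H'[of b] ab ordered_graph_induced[OF oF] by (auto simp: ramsey_graphs_iff)
  obtain c2 where c2:
      "\<not> contains (interval_union_on {Suc a..s} H) (colour_class c2 Red (induced F {v<..}))"
      "\<not> contains (interval_union_on {b..t} H') (colour_class c2 Blue (induced F {v<..}))"
    using after og ordered_graph_induced[OF oF] by (auto simp: ramsey_graphs_iff)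
  \<comment> \<open>The empty set lies on both sides of \<open>v\<close>, so \<open>c\<close> agrees
    with \<open>c2\<close> after \<open>v\<close> only on nonempty edges.\<close>
  have ne: "e \<noteq> {}" if "e \<in> edges F" for e using ordered_graph_edgeE[OF oF that] by blast
  define c where "c e = (if e \<subseteq> {..<v} then c1 e else if e \<subseteq> {v<..} then c2 e else Red)" for e
  have c_after: "c e = c2 e" if "e \<in> edges F" "e \<subseteq> {v<..}" for e
  proof -
    have "\<not> e \<subseteq> {..<v}" using ne[OF that(1)] that(2) by fastforce
    with that(2) show ?thesis by (simp add: c_def)
  qed
  consider "contains (interval_union_on {a..s} H) (colour_class c Red F)"
    | "contains (interval_union_on {b..t} H') (colour_class c Blue F)"
    using F og by (auto simp: ramsey_graphs_iff)
  then show False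
  proof cases
    case 1
    then obtain f where f: "strict_mono_on (verts (interval_union_on {a..s} H)) f"
        "f ` verts (interval_union_on {a..s} H) \<subseteq> verts F"
        "\<forall>e\<in>edges (interval_union_on {a..s} H). f ` e \<in> edges F \<and> c (f ` e) = Red"
      by (auto simp: contains_def)
    \<comment> \<open>Otherwise the red copy of \<open>H a\<close> would lie entirely before
      \<open>v\<close>, where \<open>c1\<close> forbids it. One vertex at or past \<open>v\<close>
      then pushes all later components strictly past \<open>v\<close>.\<close>
    have "\<exists>x\<in>verts (H a). v \<le> f (a, x)"
    proof (rule ccontr)
      assume "\<not> ?thesis"
      then have lt: "f (a, x) < v" if "x \<in> verts (H a)" for x using that by force
      have "(\<lambda>x. f (a, x)) ` e \<in> edges F \<and> (\<lambda>x. f (a, x)) ` e \<subseteq> {..<v} \<and>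
          c1 ((\<lambda>x. f (a, x)) ` e) = Red" if "e \<in> edges (H a)" for e
      proof -
        have "f ` Pair a ` e \<in> edges F \<and> c (f ` Pair a ` e) = Red" using f(3) that ab(1) by auto
        moreover have "e \<subseteq> verts (H a)" using H[of a] ab that by (auto simp: ordered_graph_def)
        ultimately show ?thesis using lt by (auto simp: image_image c_def split: if_splits)
      qed
      moreover have "strict_mono_on (verts (H a)) (\<lambda>x. f (a, x))"
        using f(1) ab by (auto simp: strict_mono_on_def)
      ultimately have "contains (H a) (colour_class c1 Red (induced F {..<v}))"
        using f(2) ab lt unfolding contains_def by (intro exI[of _ "\<lambda>x. f (a, x)"]) auto
      with c1 show False by blast
    qed
    then obtain x where x: "x \<in> verts (H a)" "v \<le> f (a, x)" by blast
    have gt: "v < f (i, y)" if "i \<in> {Suc a..s}" "y \<in> verts (H i)" for i y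
    proof -
      have "f (a, x) < f (i, y)"
        using that x ab by (intro strict_mono_onD[OF f(1)]) auto
      with x show ?thesis by simp
    qed
    have "f ` Pair i ` e \<in> edges F \<and> f ` Pair i ` e \<subseteq> {v<..} \<and> c2 (f ` Pair i ` e) = Red"
      if "i \<in> {Suc a..s}" "e \<in> edges (H i)" for i e
    proof -
      have "f ` Pair i ` e \<in> edges F \<and> c (f ` Pair i ` e) = Red" using f(3) that by fastforce
      moreover have "e \<subseteq> verts (H i)" using H[of i] that by (auto simp: ordered_graph_def)
      then have "f ` Pair i ` e \<subseteq> {v<..}" using gt that by auto
      ultimately show ?thesis using c_after by auto
    qed
    moreover have "strict_mono_on (verts (interval_union_on {Suc a..s} H)) f"
      using f(1) by (rule monotone_on_subset) auto
    ultimately have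
      "contains (interval_union_on {Suc a..s} H) (colour_class c2 Red (induced F {v<..}))"
      using f(2) gt unfolding contains_def by (intro exI[of _ f]) fastforce
    with c2 show False by blast
  next
    case 2
    then obtain f where f: "strict_mono_on (verts (interval_union_on {b..t} H')) f"
        "f ` verts (interval_union_on {b..t} H') \<subseteq> verts F"
        "\<forall>e\<in>edges (interval_union_on {b..t} H'). f ` e \<in> edges F \<and> c (f ` e) = Blue"
      by (auto simp: contains_def)
    let ?g = "\<lambda>x. f (b, x)"
    have e: "?g ` e \<in> edges F \<and> c (?g ` e) = Blue" if "e \<in> edges (H' b)" for e
    proof -
      have "f ` Pair b ` e \<in> edges F \<and> c (f ` Pair b ` e) = Blue" using f(3) that ab(2) by auto
      then show ?thesis by (simp add: image_image)
    qed
    have mono: "strict_mono_on (verts (H' b)) ?g"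
      using f(1) ab by (auto simp: strict_mono_on_def)
    \<comment> \<open>Edges that meet or cross \<open>v\<close> are red, so the blue copy of
      \<open>H' b\<close> uses none of them.\<close>
    have "?g ` verts (H' b) \<subseteq> {..<v} \<or> ?g ` verts (H' b) \<subseteq> {v<..}"
    proof (rule loosely_connected_one_side[OF lc mono])
      fix e assume "e \<in> edges (H' b)"
      then have "c (?g ` e) = Blue" using e by blast
      then show "?g ` e \<subseteq> {..<v} \<or> ?g ` e \<subseteq> {v<..}" unfolding c_def by (metis colour.distinct(1))
    qed
    then show False
    proof
      assume lt: "?g ` verts (H' b) \<subseteq> {..<v}"
      have "?g ` e \<subseteq> {..<v} \<and> c1 (?g ` e) = Blue" if "e \<in> edges (H' b)" for e
      proof -
        have "e \<subseteq> verts (H' b)" using H'[of b] ab that by (auto simp: ordered_graph_def)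
        with lt have "?g ` e \<subseteq> {..<v}" by blast
        with e[OF that] show ?thesis by (auto simp: c_def)
      qed
      with e lt mono f(2) ab have "contains (H' b) (colour_class c1 Blue (induced F {..<v}))"
        unfolding contains_def by (intro exI[of _ ?g]) auto
      with c1 show False by blast
    next
      assume gtb: "?g ` verts (H' b) \<subseteq> {v<..}"
      obtain x where x: "x \<in> verts (H' b)" using loosely_connected_verts_nonempty[OF lc] by blast
      \<comment> \<open>The first component already lies after \<open>v\<close>, hence so does the
        whole blue union, which \<open>c2\<close> forbids.\<close>
      have gt: "v < f (i, y)" if "i \<in> {b..t}" "y \<in> verts (H' i)" for i y
      proof (cases "i = b")
        case True then show ?thesis using gtb that by auto
      next
        case False
        then have "f (b, x) < f (i, y)"
          using that x ab by (intro strict_mono_onD[OF f(1)]) auto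
        moreover have "v < f (b, x)" using gtb x by auto
        ultimately show ?thesis by simp
      qed
      have "f ` Pair i ` e \<in> edges F \<and> f ` Pair i ` e \<subseteq> {v<..} \<and> c2 (f ` Pair i ` e) = Blue"
        if "i \<in> {b..t}" "e \<in> edges (H' i)" for i e
      proof -
        have "f ` Pair i ` e \<in> edges F \<and> c (f ` Pair i ` e) = Blue" using f(3) that by fastforce
        moreover have "e \<subseteq> verts (H' i)" using H'[of i] that by (auto simp: ordered_graph_def)
        then have "f ` Pair i ` e \<subseteq> {v<..}" using gt that by auto
        ultimately show ?thesis using c_after by auto
      qed
      then have "contains (interval_union_on {b..t} H') (colour_class c2 Blue (induced F {v<..}))"
        using f(1,2) gt unfolding contains_def by (intro exI[of _ f]) fastforce
      with c2 show False by blast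
    qed
  qed
qed

text \<open>The colouring on \<open>A\<close> decides where to look next: a red \<open>H a\<close>
  is completed by \<open>B\<close>, a blue \<open>H' b\<close> by \<open>C\<close>. Each of these
  offers either the missing components of that colour after \<open>v\<close>, or the full union in
  the other colour. \<open>B\<close> and \<open>C\<close> may overlap.\<close>

lemma ramsey_assemble:
  fixes H :: "nat \<Rightarrow> 'a::linorder ograph" and H' :: "nat \<Rightarrow> 'b::linorder ograph"
  assumes A: "A \<in> ramsey_graphs (H a) (H' b)"
    and B: "B \<in> ramsey_graphs (interval_union_on {Suc a..s} H) (interval_union_on {b..t} H')"
    and C: "C \<in> ramsey_graphs (interval_union_on {a..s} H) (interval_union_on {Suc b..t} H')"
    and cut: "verts A \<subseteq> {..v}" "verts B \<subseteq> {v<..}" "verts C \<subseteq> {v<..}"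
    and ab: "a \<le> s" "b \<le> t"
    and H: "\<And>i. i \<in> {a..s} \<Longrightarrow> ordered_graph (H i)"
    and H': "\<And>j. j \<in> {b..t} \<Longrightarrow> ordered_graph (H' j)"
  shows "graph_union A (graph_union B C) \<in>
    ramsey_graphs (interval_union_on {a..s} H) (interval_union_on {b..t} H')" (is "?F \<in> _")
proof -
  have og: "ordered_graph (interval_union_on {a..s} H)"
      "ordered_graph (interval_union_on {Suc a..s} H)"
      "ordered_graph (interval_union_on {b..t} H')"
      "ordered_graph (interval_union_on {Suc b..t} H')" "ordered_graph (H a)" "ordered_graph (H' b)"
    using H H' ab by (auto intro: ordered_graph_interval_union_on)
  have "ordered_graph ?F"
    using A B C by (intro ordered_graph_union) (auto simp: ramsey_graphs_def)
  moreover have "contains (interval_union_on {a..s} H) (colour_class c Red ?F) \<or>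
      contains (interval_union_on {b..t} H') (colour_class c Blue ?F)" for c
  proof -
    consider (red) "contains (H a) (colour_class c Red A)"
      | (blue) "contains (H' b) (colour_class c Blue A)"
      using A og by (auto simp: ramsey_graphs_iff)
    then show ?thesis
    proof cases
      case red
      consider "contains (interval_union_on {Suc a..s} H) (colour_class c Red B)"
        | "contains (interval_union_on {b..t} H') (colour_class c Blue B)"
        using B og by (auto simp: ramsey_graphs_iff)
      then show ?thesis
      proof cases
        case 1
        have "contains (interval_union_on {a..s} H) (colour_class c Red ?F)"
          using cut by (intro contains_interval_union_join[OF red 1 ab(1), where v = v]) auto
        then show ?thesis ..
      next
        case 2
        then have "contains (interval_union_on {b..t} H') (colour_class c Blue ?F)"
          by (rule contains_mono) auto
        then show ?thesis ..
      qed
    next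
      case blue
      consider "contains (interval_union_on {a..s} H) (colour_class c Red C)"
        | "contains (interval_union_on {Suc b..t} H') (colour_class c Blue C)"
        using C og by (auto simp: ramsey_graphs_iff)
      then show ?thesis
      proof cases
        case 1
        then have "contains (interval_union_on {a..s} H) (colour_class c Red ?F)"
          by (rule contains_mono) auto
        then show ?thesis ..
      next
        case 2
        have "contains (interval_union_on {b..t} H') (colour_class c Blue ?F)"
          using cut by (intro contains_interval_union_join[OF blue 2 ab(2), where v = v]) auto
        then show ?thesis ..
      qed
    qed
  qed
  ultimately show ?thesis using og by (simp add: ramsey_graphs_iff)
qed

section \<open>From finitely many minimal Ramsey graphs to bounded order\<close>

lemma subgraph_trans: "subgraph A B \<Longrightarrow> subgraph B C \<Longrightarrow> subgraph A C"
  by (auto simp: subgraph_def)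

lemma subgraph_induced: "ordered_graph F \<Longrightarrow> subgraph (induced F S) F"
  by (auto simp: subgraph_def ordered_graph_induced)

lemma subgraph_union: "subgraph A F \<Longrightarrow> subgraph B F \<Longrightarrow> subgraph (graph_union A B) F"
  by (auto simp: subgraph_def ordered_graph_union)

text \<open>Descent on vertices plus edges, since a proper subgraph may keep all the vertices or all
  the edges.\<close>

lemma ramsey_minimal_subgraph_exists:
  assumes "F \<in> ramsey_graphs H H'"
  shows "\<exists>G \<in> minimal_ramsey_graphs H H'. subgraph G F"
  using assms
proof (induction "card (verts F) + card (edges F)" arbitrary: F rule: less_induct)
  case less
  show ?case
  proof (cases "F \<in> minimal_ramsey_graphs H H'")
    case True
    moreover have "subgraph F F" using less.prems by (auto simp: subgraph_def ramsey_graphs_def)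
    ultimately show ?thesis by blast
  next
    case False
    then obtain G where G: "subgraph G F" "G \<noteq> F" "G \<in> ramsey_graphs H H'"
      using less.prems by (auto simp: minimal_ramsey_graphs_def)
    have fin: "finite (verts F)" "finite (edges F)"
      using less.prems
      by (auto simp: ramsey_graphs_def ordered_graph_def intro: finite_subset[of _ "Pow (verts F)"])
    have sub: "verts G \<subseteq> verts F" "edges G \<subseteq> edges F" using G by (auto simp: subgraph_def)
    have "verts G \<noteq> verts F \<or> edges G \<noteq> edges F" using G(2) by auto
    then have "card (verts G) + card (edges G) < card (verts F) + card (edges F)"
    proof
      assume "verts G \<noteq> verts F"
      then show ?thesis
        using psubset_card_mono[OF fin(1), of "verts G"] card_mono[OF fin(2) sub(2)] sub by force
    next
      assume "edges G \<noteq> edges F"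
      then show ?thesis
        using psubset_card_mono[OF fin(2), of "edges G"] card_mono[OF fin(1) sub(1)] sub by force
    qed
    from less.hyps[OF this G(3)] G(1) show ?thesis by (meson subgraph_trans)
  qed
qed

lemma order_isomorphic_card: "order_isomorphic F G \<Longrightarrow> card (verts F) = card (verts G)"
  by (auto simp: order_isomorphic_def dest: bij_betw_same_card)

lemma ramsey_finite_imp_bounded:
  assumes "ramsey_finite H H'"
  shows "ramsey_bounded H H'"
proof -
  obtain M :: "nat ograph set" where M: "finite M"
      "\<forall>F :: nat ograph. F \<in> minimal_ramsey_graphs H H' \<longrightarrow> (\<exists>G\<in>M. order_isomorphic F G)"
    using assms unfolding ramsey_finite_def by (elim exE conjE)
  \<comment> \<open>The sum serves as an upper bound for the orders in \<open>M\<close>; unlike a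
    maximum it also makes sense for empty \<open>M\<close>.\<close>
  define n where "n = (\<Sum>G\<in>M. card (verts G))"
  have "\<exists>G \<in> ramsey_graphs H H'. subgraph G F \<and> card (verts G) \<le> n"
    if F: "F \<in> ramsey_graphs H H'" for F :: "nat ograph"
  proof -
    obtain G where G: "G \<in> minimal_ramsey_graphs H H'" "subgraph G F"
      using ramsey_minimal_subgraph_exists[OF F] by blast
    obtain K where K: "K \<in> M" "order_isomorphic G K" using M(2) G(1) by blast
    have "card (verts K) \<le> n" unfolding n_def using M(1) K(1) by (intro member_le_sum) auto
    then have "card (verts G) \<le> n" using order_isomorphic_card[OF K(2)] by simp
    then show ?thesis using G by (auto simp: minimal_ramsey_graphs_def)
  qed
  then show ?thesis unfolding ramsey_bounded_def by blast
qed

section \<open>Ranks as an isomorphism invariant, and the way back to finiteness\<close>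

definition rank :: "'a::linorder ograph \<Rightarrow> 'a \<Rightarrow> nat" where
  "rank F x = card {y \<in> verts F. y < x}"

text \<open>This encodes the canonical copy of \<open>F\<close> on an initial segment of the
  naturals. For finite vertex sets equal signatures force isomorphism, and a bounded order leaves
  finitely many signatures.\<close>

definition signature :: "'a::linorder ograph \<Rightarrow> nat \<times> (nat \<times> nat) set" where
  "signature F = (card (verts F),
     {(rank F u, rank F v) | u v. u \<in> verts F \<and> v \<in> verts F \<and> {u, v} \<in> edges F})"

lemma rank_strict_mono: "finite (verts F) \<Longrightarrow> strict_mono_on (verts F) (rank F)"
  unfolding rank_def by (rule strict_mono_onI) (auto intro!: psubset_card_mono)

lemma rank_less: "finite (verts F) \<Longrightarrow> x \<in> verts F \<Longrightarrow> rank F x < card (verts F)"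
  unfolding rank_def by (rule psubset_card_mono) auto

lemma rank_bij:
  assumes "finite (verts F)"
  shows "bij_betw (rank F) (verts F) {..<card (verts F)}"
proof -
  have inj: "inj_on (rank F) (verts F)"
    using rank_strict_mono[OF assms] by (rule strict_mono_on_imp_inj_on)
  have "rank F ` verts F = {..<card (verts F)}"
    using rank_less[OF assms] by (intro card_subset_eq) (auto simp: card_image[OF inj])
  with inj show ?thesis by (simp add: bij_betw_def)
qed

lemma rank_mem_signature_iff:
  assumes "finite (verts F)" "u \<in> verts F" "v \<in> verts F"
  shows "(rank F u, rank F v) \<in> snd (signature F) \<longleftrightarrow> {u, v} \<in> edges F"
  using assms inj_onD[OF strict_mono_on_imp_inj_on[OF rank_strict_mono[OF assms(1)]]]
  by (auto simp: signature_def)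

lemma order_isomorphic_if_signature_eq:
  assumes fin: "finite (verts F)" "finite (verts G)" and sig: "signature F = signature G"
  shows "order_isomorphic F G"
proof -
  have card: "card (verts F) = card (verts G)" using sig by (simp add: signature_def)
  \<comment> \<open>Match vertices of equal rank.\<close>
  define f where "f = inv_into (verts G) (rank G) \<circ> rank F"
  have bij: "bij_betw f (verts F) (verts G)"
    unfolding f_def
    using rank_bij[OF fin(1)] bij_betw_inv_into[OF rank_bij[OF fin(2)]] card
    by (intro bij_betw_trans[of _ _ "{..<card (verts G)}"]) auto
  have rf: "rank G (f x) = rank F x" if "x \<in> verts F" for x
    using rank_less[OF fin(1) that] bij_betw_inv_into_right[OF rank_bij[OF fin(2)]] card
    by (simp add: f_def)
  have fV: "f x \<in> verts G" if "x \<in> verts F" for x using bij that by (auto simp: bij_betw_def)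
  have "f x < f y" if "x \<in> verts F" "y \<in> verts F" "x < y" for x y
  proof -
    have "rank G (f x) < rank G (f y)"
      using strict_mono_onD[OF rank_strict_mono[OF fin(1)]] that by (simp add: rf)
    then show ?thesis
      using strict_mono_on_less[OF rank_strict_mono[OF fin(2)] fV fV] that by blast
  qed
  then have "strict_mono_on (verts F) f" by (rule strict_mono_onI)
  moreover have "{u, v} \<in> edges F \<longleftrightarrow> {f u, f v} \<in> edges G"
    if "u \<in> verts F" "v \<in> verts F" for u v
    using rank_mem_signature_iff[OF fin(1) that] rank_mem_signature_iff[OF fin(2) fV fV, of u v]
      that sig by (simp add: rf)
  ultimately show ?thesis using bij unfolding order_isomorphic_def by blast
qed

lemma ramsey_bounded_imp_finite:
  assumes "ramsey_bounded H H'"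
  shows "ramsey_finite H H'"
proof -
  let ?R = "minimal_ramsey_graphs H H' :: nat ograph set"
  obtain n where n: "\<And>F :: nat ograph. F \<in> ramsey_graphs H H' \<Longrightarrow>
      \<exists>G \<in> ramsey_graphs H H'. subgraph G F \<and> card (verts G) \<le> n"
    using assms unfolding ramsey_bounded_def by blast
  have fin: "finite (verts F)" if "F \<in> ?R" for F
    using that by (auto simp: minimal_ramsey_graphs_def ramsey_graphs_def ordered_graph_def)
  \<comment> \<open>By minimality the small Ramsey subgraph of \<open>F\<close> can only be
    \<open>F\<close> itself.\<close>
  have card: "card (verts F) \<le> n" if "F \<in> ?R" for F
    using that n[of F] unfolding minimal_ramsey_graphs_def by blast
  have "signature F \<in> {..n} \<times> Pow ({..<n} \<times> {..<n})" if "F \<in> ?R" for F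
    using rank_less[OF fin[OF that]] card[OF that] by (fastforce simp: signature_def)
  then have "signature ` ?R \<subseteq> {..n} \<times> Pow ({..<n} \<times> {..<n})" by (rule image_subsetI)
  then have "finite (signature ` ?R)" by (rule finite_subset) simp
  \<comment> \<open>\<open>M\<close> is a finite set of minimal graphs that realises every signature
    occurring among them.\<close>
  then obtain M where M: "M \<subseteq> ?R" "finite M" "signature ` ?R = signature ` M"
    using finite_subset_image[of "signature ` ?R" signature ?R] by auto
  have "\<exists>G\<in>M. order_isomorphic F G" if F: "F \<in> ?R" for F
  proof -
    obtain G where "G \<in> M" "signature F = signature G" using M(3) F by (metis imageE imageI)
    then show ?thesis using order_isomorphic_if_signature_eq fin F M(1) by blast
  qed
  with M show ?thesis unfolding ramsey_finite_def by blast
qed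

section \<open>Induction on the number of components\<close>

lemma ramsey_bounded_commute: "ramsey_bounded H H' \<longleftrightarrow> ramsey_bounded H' H"
  unfolding ramsey_bounded_def by (simp add: ramsey_graphs_commute[of H H'])

text \<open>A graph without vertices embeds everywhere, so the empty graph is Ramsey and is a
  subgraph of every \<open>F\<close>; the bound is 0.\<close>

lemma ramsey_bounded_empty:
  assumes H: "ordered_graph H" "verts H = {}" and H': "ordered_graph H'"
  shows "ramsey_bounded H H'"
proof -
  let ?E = "\<lparr>verts = {}, edges = {}\<rparr> :: nat ograph"
  have "edges H = {}" using H by (fastforce simp: ordered_graph_def)
  then have "contains H (colour_class c q ?E)" for c q
    using H by (simp add: contains_def strict_mono_on_def)
  moreover have "ordered_graph ?E" by (simp add: ordered_graph_def)
  ultimately have "?E \<in> ramsey_graphs H H'" using H H' by (simp add: ramsey_graphs_iff)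
  moreover have "subgraph ?E F" for F by (simp add: subgraph_def ordered_graph_def)
  ultimately show ?thesis unfolding ramsey_bounded_def by (intro exI[of _ 0]) force
qed

lemma ramsey_bounded_interval_union_on:
  fixes H :: "nat \<Rightarrow> 'a::linorder ograph" and H' :: "nat \<Rightarrow> 'b::linorder ograph"
  assumes "\<And>i. i \<in> {a..s} \<Longrightarrow> ordered_graph (H i) \<and> loosely_connected (H i)"
    and "\<And>j. j \<in> {b..t} \<Longrightarrow> ordered_graph (H' j) \<and> loosely_connected (H' j)"
    and "\<And>i j. i \<in> {a..s} \<Longrightarrow> j \<in> {b..t} \<Longrightarrow> ramsey_bounded (H i) (H' j)"
  shows "ramsey_bounded (interval_union_on {a..s} H) (interval_union_on {b..t} H')"
  using assms
\<comment> \<open>The measure counts the components left on both sides. Truncated subtraction gives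
  0 once an index range is exhausted, which is the empty-graph case.\<close>
proof (induction "(Suc s - a) + (Suc t - b)" arbitrary: a b rule: less_induct)
  case less
  let ?U = "\<lambda>a. interval_union_on {a..s} H" and ?U' = "\<lambda>b. interval_union_on {b..t} H'"
  have og: "ordered_graph (?U a)" "ordered_graph (?U' b)"
    using less.prems by (auto intro: ordered_graph_interval_union_on)
  consider "s < a" | "t < b" | "a \<le> s" "b \<le> t" by linarith
  then show ?case
  proof cases
    case 1
    then show ?thesis using og by (intro ramsey_bounded_empty) auto
  next
    case 2
    then have "ramsey_bounded (?U' b) (?U a)" using og by (intro ramsey_bounded_empty) auto
    then show ?thesis by (rule ramsey_bounded_commute[THEN iffD1])
  next
    case 3
    have "ramsey_bounded (H a) (H' b)" using less.prems 3 by simp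
    moreover have "ramsey_bounded (?U (Suc a)) (?U' b)"
      using less.prems 3 by (intro less.hyps) auto
    moreover have "ramsey_bounded (?U a) (?U' (Suc b))"
      using less.prems 3 by (intro less.hyps) auto
    ultimately obtain k l m where
      k: "\<And>F :: nat ograph. F \<in> ramsey_graphs (H a) (H' b) \<Longrightarrow>
        \<exists>G \<in> ramsey_graphs (H a) (H' b). subgraph G F \<and> card (verts G) \<le> k"
      and l: "\<And>F :: nat ograph. F \<in> ramsey_graphs (?U (Suc a)) (?U' b) \<Longrightarrow>
        \<exists>G \<in> ramsey_graphs (?U (Suc a)) (?U' b). subgraph G F \<and> card (verts G) \<le> l"
      and m: "\<And>F :: nat ograph. F \<in> ramsey_graphs (?U a) (?U' (Suc b)) \<Longrightarrow>
        \<exists>G \<in> ramsey_graphs (?U a) (?U' (Suc b)). subgraph G F \<and> card (verts G) \<le> m"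
      unfolding ramsey_bounded_def by blast
    have H: "\<And>i. i \<in> {a..s} \<Longrightarrow> ordered_graph (H i)" "loosely_connected (H a)"
      and H': "\<And>j. j \<in> {b..t} \<Longrightarrow> ordered_graph (H' j)" "loosely_connected (H' b)"
      using less.prems 3 by auto
    have oHa: "ordered_graph (H a)" "ordered_graph (H' b)" using H H' 3 by auto
    have "\<exists>G \<in> ramsey_graphs (?U a) (?U' b). subgraph G F \<and> card (verts G) \<le> k + l + m"
      if F: "F \<in> ramsey_graphs (?U a) (?U' b)" for F :: "nat ograph"
    proof -
      have oF: "ordered_graph F" using F by (simp add: ramsey_graphs_def)
      let ?P = "\<lambda>v. induced F {..v} \<in> ramsey_graphs (H a) (H' b)"
      \<comment> \<open>A union contains its first component, so \<open>F\<close> is Ramsey for the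
        first components too. Hence some initial part of \<open>F\<close> is, and a least cut point
        exists.\<close>
      have FHa: "F \<in> ramsey_graphs (H a) (H' b)"
        using F og oHa 3 contains_component[of "{a..s}" H _ a] contains_component[of "{b..t}" H' _ b]
        by (auto simp: ramsey_graphs_iff)
      obtain w where w: "verts F \<subseteq> {..w}"
        using oF finite_nat_set_iff_bounded_le[of "verts F"] by (auto simp: ordered_graph_def)
      then have "induced F {..w} = F"
        using oF by (auto simp: induced_def ordered_graph_def intro!: ograph.equality)
      with FHa have "?P w" by simp
      define v where "v = (LEAST v. ?P v)"
      have v: "?P v" unfolding v_def using \<open>?P w\<close> by (rule LeastI)
      \<comment> \<open>If \<open>v\<close> is 0, the part before it is empty and cannot host the
        nonempty \<open>H a\<close> or \<open>H' b\<close>. Otherwise that part ends at the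
        predecessor of \<open>v\<close>, where leastness applies.\<close>
      have nv: "induced F {..<v} \<notin> ramsey_graphs (H a) (H' b)"
      proof (cases v)
        case 0
        have "\<not> contains (H a) (colour_class c q (induced F {..<v}))"
          "\<not> contains (H' b) (colour_class c q (induced F {..<v}))" for c q
          using 0 loosely_connected_verts_nonempty H(2) H'(2) by (auto simp: contains_def)
        then show ?thesis using oHa by (simp add: ramsey_graphs_iff)
      next
        case (Suc u)
        then have "\<not> ?P u" unfolding v_def by (intro not_less_Least) simp
        then show ?thesis using Suc by (simp add: lessThan_Suc_atMost)
      qed
      have 1: "induced F {v<..} \<in> ramsey_graphs (?U (Suc a)) (?U' b)"
        using F 3 H(1) H' nv by (rule ramsey_after_cut)
      \<comment> \<open>The same cut with the colours exchanged: now the first component of the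
        other union is dropped.\<close>
      have "induced F {v<..} \<in> ramsey_graphs (?U' (Suc b)) (?U a)"
        using F 3(2,1) H'(1) H nv unfolding ramsey_graphs_commute[of "?U a" "?U' b"]
          ramsey_graphs_commute[of "H a" "H' b"]
        by (rule ramsey_after_cut)
      then have 2: "induced F {v<..} \<in> ramsey_graphs (?U a) (?U' (Suc b))"
        by (rule ramsey_graphs_swap)
      obtain A B C where
        A: "A \<in> ramsey_graphs (H a) (H' b)" "subgraph A (induced F {..v})" "card (verts A) \<le> k"
        and B: "B \<in> ramsey_graphs (?U (Suc a)) (?U' b)" "subgraph B (induced F {v<..})"
          "card (verts B) \<le> l"
        and C: "C \<in> ramsey_graphs (?U a) (?U' (Suc b))" "subgraph C (induced F {v<..})"
          "card (verts C) \<le> m"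
        using k[OF v] l[OF 1] m[OF 2] by blast
      let ?G = "graph_union A (graph_union B C)"
      have "?G \<in> ramsey_graphs (?U a) (?U' b)"
        using A(2) B(2) C(2) 3 H(1) H'(1)
        by (intro ramsey_assemble[OF A(1) B(1) C(1), where v = v]) (auto simp: subgraph_def)
      moreover have "subgraph ?G F"
        using A(2) B(2) C(2) by (meson oF subgraph_induced subgraph_trans subgraph_union)
      moreover have "card (verts ?G) \<le> k + l + m"
        using card_Un_le[of "verts A" "verts B \<union> verts C"] card_Un_le[of "verts B" "verts C"]
          A(3) B(3) C(3) by simp
      ultimately show ?thesis by blast
    qed
    then show ?thesis unfolding ramsey_bounded_def by blast
  qed
qed

theorem theorem9:
  fixes s t :: nat
    and H :: "nat \<Rightarrow> 'a::linorder ograph"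
    and H' :: "nat \<Rightarrow> 'b::linorder ograph"
  assumes "s \<ge> 1" and "t \<ge> 1"
    and "\<And>i. i \<in> {1..s} \<Longrightarrow> ordered_graph (H i) \<and> loosely_connected (H i)"
    and "\<And>j. j \<in> {1..t} \<Longrightarrow> ordered_graph (H' j) \<and> loosely_connected (H' j)"
    and "\<And>i j. i \<in> {1..s} \<Longrightarrow> j \<in> {1..t} \<Longrightarrow> ramsey_finite (H i) (H' j)"
  shows "ramsey_finite (interval_union s H) (interval_union t H')"
proof -
  have "ramsey_bounded (interval_union_on {1..s} H) (interval_union_on {1..t} H')"
    using assms(3-5) by (intro ramsey_bounded_interval_union_on ramsey_finite_imp_bounded) auto
  then show ?thesis
    using interval_union_eq[of s H] interval_union_eq[of t H'] assms(3,4) ramsey_bounded_imp_finite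
    by metis
qed

end
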